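(* Let $p\in(1,\infty)\setminus\{2\}$ and let $x=(x_n)_{n\in\mathbb{N}}$ and $y=(y_n)_{n\in\mathbb{N}}$ be elements of $\ell_p$ over $\mathbb{K}$. Then $x\perp_B y$ if and only if $$\sum_{n=1}^\infty\overline{\operatorname{sgn}(x_n)}\,|x_n|^{p-1}y_n=0.$$
   Context: $\mathbb{K}$ is $\mathbb{R}$ or $\mathbb{C}$. $\ell_p$ is the space of $p$-summable sequences in $\mathbb{K}$ with norm $\|x\|_p=(\sum_n|x_n|^p)^{1/p}$. $\operatorname{sgn}(t)=t/|t|$ for $t\neq0$ and $\operatorname{sgn}(0)=0$. $x\perp_B y$ (Birkhoff-James orthogonality) means $\|x+\lambda y\|_p\ge\|x\|_p$ for all $\lambda\in\mathbb{K}$. *)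

theory Defs
  imports "HOL-Analysis.Analysis"
begin

text \<open>
  The class of \<open>'a\<close> is only a common home for the two scalar fields of interest,
  \<^typ>\<open>real\<close> and \<^typ>\<open>complex\<close>.
\<close>

definition lp :: "real \<Rightarrow> (nat \<Rightarrow> 'a::real_normed_field) set" where
  "lp p = {x. summable (\<lambda>n. norm (x n) powr p)}"

definition lp_norm :: "real \<Rightarrow> (nat \<Rightarrow> 'a::real_normed_field) \<Rightarrow> real" where
  "lp_norm p x = (\<Sum>n. norm (x n) powr p) powr (1 / p)"

text \<open>
  Birkhoff-James orthogonality in \<open>lp p\<close>, with the scalar ranging over the whole field \<open>'a\<close>.
  It is meant for \<open>x, y \<in> lp p\<close> and \<open>p \<ge> 1\<close>; outside \<open>lp p\<close> the value of
  \<^const>\<open>lp_norm\<close> is meaningless.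
\<close>
definition bj_orthogonal ::
    "real \<Rightarrow> (nat \<Rightarrow> 'a::real_normed_field) \<Rightarrow> (nat \<Rightarrow> 'a) \<Rightarrow> bool" where
  "bj_orthogonal p x y \<longleftrightarrow> (\<forall>c::'a. lp_norm p (\<lambda>n. x n + c * y n) \<ge> lp_norm p x)"

end

theory Submission
  imports Defs
begin

text \<open>
  The function \<open>v \<mapsto> |v|\<^sup>p\<close> on \<open>\<real>\<close> or \<open>\<complex>\<close>, regarded as a real inner product space, is convex with
  gradient \<open>p * J v\<close>, where \<open>J v = |v|\<^sup>p\<^sup>-\<^sup>1 sgn v\<close>. Orthogonality of \<open>x\<close> to \<open>y\<close> says that the convex
  functional \<open>x \<mapsto> \<Sum>n. |x\<^sub>n|\<^sup>p\<close> has a minimum at \<open>x\<close> on the scalar line through \<open>x\<close> in direction \<open>y\<close>,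
  which should happen exactly when the gradient vanishes on that line:
  \<open>\<Sum>n. J x\<^sub>n \<bullet> (c y\<^sub>n) = 0\<close> for every scalar \<open>c\<close>.

  No differentiation is carried out; both directions use the gradient inequality
  \<open>|a + b|\<^sup>p \<ge> |a|\<^sup>p + p (J a \<bullet> b)\<close> (\<open>norm_powr_gradient_ineq\<close>), which is Young's inequality.
  Summed over \<open>n\<close> at the points \<open>x\<^sub>n\<close>, it shows that a vanishing gradient gives a minimum.
  Applied instead at the points \<open>x\<^sub>n + t z\<^sub>n\<close> with increment \<open>-t z\<^sub>n\<close>, it shows that at a minimum
  \<open>\<Sum>n. J (x\<^sub>n + t z\<^sub>n) \<bullet> z\<^sub>n \<ge> 0\<close> for \<open>t > 0\<close>. Since \<open>J\<close> is continuous (this is where \<open>p > 1\<close> matters)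
  and the terms are dominated by \<open>(|x\<^sub>n| + |z\<^sub>n|)\<^sup>p\<close>, Tannery's theorem lets \<open>t\<close> tend to \<open>0\<close>
  (\<open>minimum_imp_gradient_nonneg\<close>). Replacing \<open>z\<close> by \<open>-z\<close> gives equality.

  Finally \<open>J x\<^sub>n \<bullet> (c y\<^sub>n)\<close> is the real part of \<open>c\<close> times the \<open>n\<close>-th term of the series in question, and
  a scalar \<open>S\<close> with \<open>Re (c S) = 0\<close> for all \<open>c\<close> is \<open>0\<close>, as the conjugate of \<open>S\<close> is an admissible \<open>c\<close>.
\<close>

section \<open>The gradient of the p-th power of a norm\<close>

text \<open>
  This is the gradient of \<open>v \<mapsto> |v|\<^sup>p / p\<close> on an inner product space; applied coordinatewise, it is
  the duality mapping of the sequence space for the gauge \<open>r \<mapsto> r\<^sup>p\<^sup>-\<^sup>1\<close>, up to conjugation.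
\<close>

definition duality_map :: "real \<Rightarrow> 'a::real_normed_vector \<Rightarrow> 'a" where
  "duality_map p v = (norm v powr (p - 1)) *\<^sub>R sgn v"

lemma norm_duality_map: "norm (duality_map p v) = norm v powr (p - 1)"
  by (cases "v = 0") (simp_all add: duality_map_def norm_sgn)

lemma inner_duality_map_self:
  fixes v :: "'a::real_inner"
  assumes "1 < p"
  shows "duality_map p v \<bullet> v = norm v powr p"
proof (cases "v = 0")
  case False
  have "duality_map p v \<bullet> v = norm v powr (p - 1) * norm v"
    using False by (simp add: duality_map_def sgn_div_norm dot_square_norm power2_eq_square)
  also have "\<dots> = norm v powr p"
    using False by (simp add: powr_diff)
  finally show ?thesis .
qed (simp add: duality_map_def)

text \<open>
  The value \<open>duality_map p 0 = 0\<close> is the correct continuous extension only because the norm of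
  \<open>duality_map p v\<close> is a positive power of \<open>norm v\<close>; at nonzero points \<open>sgn\<close> is itself continuous.
\<close>

lemma tendsto_duality_map:
  fixes f :: "'b \<Rightarrow> 'a::real_normed_vector"
  assumes p: "1 < p" and f: "(f \<longlongrightarrow> l) F"
  shows "((\<lambda>t. duality_map p (f t)) \<longlongrightarrow> duality_map p l) F"
proof (cases "l = 0")
  case True
  have "((\<lambda>t. norm (f t) powr (p - 1)) \<longlongrightarrow> 0) F"
    using p f True by (intro tendsto_zero_powrI[where b = "p - 1"]) (auto intro: tendsto_norm_zero)
  then have "((\<lambda>t. duality_map p (f t)) \<longlongrightarrow> 0) F"
    by (simp flip: norm_duality_map add: tendsto_norm_zero_iff)
  then show ?thesis
    using True by (simp add: duality_map_def)
next
  case False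
  then show ?thesis
    unfolding duality_map_def by (intro tendsto_intros f) auto
qed

text \<open>
  By Cauchy-Schwarz and Young, \<open>J a \<bullet> (a + b) \<le> |a|\<^sup>p\<^sup>-\<^sup>1 |a + b| \<le> |a + b|\<^sup>p / p + |a|\<^sup>p / q\<close> with
  \<open>q\<close> the conjugate exponent; subtracting \<open>J a \<bullet> a = |a|\<^sup>p\<close> gives the claim.
\<close>

lemma norm_powr_gradient_ineq:
  fixes a b :: "'a::real_inner"
  assumes p: "1 < p"
  shows "norm a powr p + p * (duality_map p a \<bullet> b) \<le> norm (a + b) powr p"
proof -
  define q where "q = p / (p - 1)"
  have q: "1 < q" "1 / p + 1 / q = 1"
    using p by (simp_all add: q_def field_simps)
  have pq: "(norm a powr (p - 1)) powr q = norm a powr p"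
    using p by (simp add: powr_powr q_def)
  have "duality_map p a \<bullet> (a + b) \<le> norm (a + b) * norm a powr (p - 1)"
    using norm_cauchy_schwarz[of "duality_map p a" "a + b"] by (simp add: norm_duality_map mult.commute)
  also have "\<dots> \<le> norm (a + b) powr p / p + norm a powr p / q"
    using Youngs_inequality[OF p q, of "norm (a + b)" "norm a powr (p - 1)"] by (simp add: pq)
  finally have "norm a powr p + duality_map p a \<bullet> b \<le> norm (a + b) powr p / p + norm a powr p / q"
    by (simp add: inner_add_right inner_duality_map_self[OF p])
  moreover have "norm a powr p / q = norm a powr p - norm a powr p / p"
    using p by (simp add: q_def field_simps)
  ultimately have "norm a powr p / p + duality_map p a \<bullet> b \<le> norm (a + b) powr p / p"
    by simp
  then have "p * (norm a powr p / p + duality_map p a \<bullet> b) \<le> p * (norm (a + b) powr p / p)"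
    using p by (intro mult_left_mono) auto
  then show ?thesis
    using p by (simp add: distrib_left)
qed

section \<open>Summability of the perturbed series\<close>

lemma add_powr_le:
  fixes a b p :: real
  assumes "0 \<le> a" "0 \<le> b" "0 \<le> p"
  shows "(a + b) powr p \<le> 2 powr p * (a powr p + b powr p)"
proof -
  have "(a + b) powr p \<le> (2 * max a b) powr p"
    using assms by (intro powr_mono2) auto
  also have "\<dots> = 2 powr p * max a b powr p"
    using assms by (simp add: powr_mult)
  also have "\<dots> \<le> 2 powr p * (a powr p + b powr p)"
    by (intro mult_left_mono) (auto simp: max_def)
  finally show ?thesis .
qed

lemma summable_add_norm_powr:
  fixes x y :: "nat \<Rightarrow> 'a::real_normed_vector"
  assumes "0 \<le> p" and "summable (\<lambda>n. norm (x n) powr p)" and "summable (\<lambda>n. norm (y n) powr p)"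
  shows "summable (\<lambda>n. (norm (x n) + norm (y n)) powr p)"
proof (rule summable_comparison_test')
  show "summable (\<lambda>n. 2 powr p * (norm (x n) powr p + norm (y n) powr p))"
    using assms by (intro summable_mult summable_add)
  show "norm ((norm (x n) + norm (y n)) powr p) \<le> 2 powr p * (norm (x n) powr p + norm (y n) powr p)"
    if "n \<ge> 0" for n
    using assms add_powr_le[of "norm (x n)" "norm (y n)" p] by simp
qed

lemma summable_norm_add_powr:
  fixes x y :: "nat \<Rightarrow> 'a::real_normed_vector"
  assumes "0 \<le> p" and "summable (\<lambda>n. norm (x n) powr p)" and "summable (\<lambda>n. norm (y n) powr p)"
  shows "summable (\<lambda>n. norm (x n + y n) powr p)"
proof (rule summable_comparison_test'[OF summable_add_norm_powr[OF assms]])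
  show "norm (norm (x n + y n) powr p) \<le> (norm (x n) + norm (y n)) powr p" if "n \<ge> 0" for n
    using assms(1) by (simp add: powr_mono2 norm_triangle_ineq)
qed

text \<open>
  A crude replacement for Hoelder's inequality, with the advantage that a bound in terms of
  \<open>r + norm b\<close> serves as the dominating series uniformly in the perturbation.
\<close>

lemma norm_duality_map_mult_le:
  assumes p: "1 < p" and "norm a \<le> r + norm b" and "0 \<le> r"
  shows "norm (duality_map p a) * norm b \<le> (r + norm b) powr p"
proof -
  have "norm (duality_map p a) * norm b \<le> (r + norm b) powr (p - 1) * (r + norm b)"
    unfolding norm_duality_map using assms by (intro mult_mono powr_mono2) auto
  also have "\<dots> = (r + norm b) powr p"
  proof (cases "r + norm b = 0")
    case False
    then show ?thesis using assms by (simp add: powr_diff)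
  qed (use p in simp)
  finally show ?thesis .
qed

lemma summable_duality_map_mult:
  fixes x z :: "nat \<Rightarrow> 'a::real_normed_vector"
  assumes p: "1 < p"
    and x: "summable (\<lambda>n. norm (x n) powr p)" and z: "summable (\<lambda>n. norm (z n) powr p)"
  shows "summable (\<lambda>n. norm (duality_map p (x n)) * norm (z n))"
proof (rule summable_comparison_test')
  show "summable (\<lambda>n. (norm (x n) + norm (z n)) powr p)"
    using p x z by (intro summable_add_norm_powr) auto
  show "norm (norm (duality_map p (x n)) * norm (z n)) \<le> (norm (x n) + norm (z n)) powr p"
    if "n \<ge> 0" for n
    using norm_duality_map_mult_le[OF p, of "x n" "norm (x n)" "z n"] by simp
qed

lemma summable_inner_duality_map:
  fixes x z :: "nat \<Rightarrow> 'a::real_inner"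
  assumes p: "1 < p"
    and x: "summable (\<lambda>n. norm (x n) powr p)" and z: "summable (\<lambda>n. norm (z n) powr p)"
  shows "summable (\<lambda>n. duality_map p (x n) \<bullet> z n)"
  by (rule summable_comparison_test'[OF summable_duality_map_mult[OF assms]])
    (simp add: Cauchy_Schwarz_ineq2)

section \<open>Minima along a line\<close>

lemma gradient_zero_imp_minimum:
  fixes x z :: "nat \<Rightarrow> 'a::real_inner"
  assumes p: "1 < p"
    and x: "summable (\<lambda>n. norm (x n) powr p)" and z: "summable (\<lambda>n. norm (z n) powr p)"
    and zero: "(\<Sum>n. duality_map p (x n) \<bullet> z n) = 0"
  shows "(\<Sum>n. norm (x n) powr p) \<le> (\<Sum>n. norm (x n + z n) powr p)"
proof -
  note s = summable_inner_duality_map[OF p x z]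
  have "(\<Sum>n. norm (x n) powr p) = (\<Sum>n. norm (x n) powr p) + (\<Sum>n. p * (duality_map p (x n) \<bullet> z n))"
    using zero suminf_mult[OF s, of p] by simp
  also have "\<dots> = (\<Sum>n. norm (x n) powr p + p * (duality_map p (x n) \<bullet> z n))"
    by (intro suminf_add x summable_mult s)
  also have "\<dots> \<le> (\<Sum>n. norm (x n + z n) powr p)"
    using p x z
    by (intro suminf_le norm_powr_gradient_ineq summable_add summable_mult s summable_norm_add_powr) auto
  finally show ?thesis .
qed

text \<open>
  The gradient inequality at the displaced points \<open>x\<^sub>n + t z\<^sub>n\<close> bounds the increment
  \<open>\<Sum>n. |x\<^sub>n + t z\<^sub>n|\<^sup>p - \<Sum>n. |x\<^sub>n|\<^sup>p\<close> from above by a positive multiple of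
  \<open>\<Sum>n. J (x\<^sub>n + t z\<^sub>n) \<bullet> z\<^sub>n\<close>, so at a minimum the latter is nonnegative; then \<open>t\<close> tends to \<open>0\<close>.
\<close>

lemma minimum_imp_gradient_nonneg:
  fixes x z :: "nat \<Rightarrow> 'a::real_inner"
  assumes p: "1 < p"
    and x: "summable (\<lambda>n. norm (x n) powr p)" and z: "summable (\<lambda>n. norm (z n) powr p)"
    and minimum: "\<And>t::real. (\<Sum>n. norm (x n) powr p) \<le> (\<Sum>n. norm (x n + t *\<^sub>R z n) powr p)"
  shows "0 \<le> (\<Sum>n. duality_map p (x n) \<bullet> z n)"
proof -
  let ?g = "\<lambda>t n. duality_map p (x n + t *\<^sub>R z n) \<bullet> z n"
  have nonneg: "0 \<le> (\<Sum>n. ?g t n)" if t: "0 < t" for t :: real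
  proof -
    have tz: "summable (\<lambda>n. norm (t *\<^sub>R z n) powr p)"
      using summable_mult[OF z, of "\<bar>t\<bar> powr p"] by (simp add: powr_mult)
    have xtz: "summable (\<lambda>n. norm (x n + t *\<^sub>R z n) powr p)"
      using p x tz by (intro summable_norm_add_powr) auto
    note s = summable_inner_duality_map[OF p xtz z]
    have "norm (x n + t *\<^sub>R z n) powr p - (p * t) * ?g t n \<le> norm (x n) powr p" for n
      using norm_powr_gradient_ineq[OF p, of "x n + t *\<^sub>R z n" "- (t *\<^sub>R z n)"]
      by (simp add: mult.assoc)
    then have "(\<Sum>n. norm (x n + t *\<^sub>R z n) powr p - (p * t) * ?g t n) \<le> (\<Sum>n. norm (x n) powr p)"
      by (intro suminf_le summable_diff summable_mult s xtz x) auto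
    also have "(\<Sum>n. norm (x n + t *\<^sub>R z n) powr p - (p * t) * ?g t n)
        = (\<Sum>n. norm (x n + t *\<^sub>R z n) powr p) - (p * t) * (\<Sum>n. ?g t n)"
      using suminf_diff[OF xtz summable_mult[OF s, of "p * t"]] suminf_mult[OF s, of "p * t"] by simp
    finally have "0 \<le> (p * t) * (\<Sum>n. ?g t n)"
      using minimum[of t] by simp
    moreover have "0 < p * t"
      using p t by simp
    ultimately show ?thesis
      by (simp only: zero_le_mult_iff) linarith
  qed
  have "((\<lambda>t. ?g t n) \<longlongrightarrow> duality_map p (x n) \<bullet> z n) (at_right 0)" for n
    by (intro tendsto_inner tendsto_duality_map[OF p] tendsto_const)
      (auto intro!: tendsto_eq_intros)
  moreover have "\<forall>\<^sub>F (n, t) in at_top \<times>\<^sub>F at_right 0. norm (?g t n) \<le> (norm (x n) + norm (z n)) powr p"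
  proof -
    have "norm (?g t n) \<le> (norm (x n) + norm (z n)) powr p" if "0 < t" "t < 1" for t :: real and n
    proof -
      have "norm (x n + t *\<^sub>R z n) \<le> norm (x n) + \<bar>t\<bar> * norm (z n)"
        by (metis norm_scaleR norm_triangle_ineq)
      also have "\<dots> \<le> norm (x n) + norm (z n)"
        using that by (simp add: mult_left_le_one_le)
      finally have "norm (duality_map p (x n + t *\<^sub>R z n)) * norm (z n) \<le> (norm (x n) + norm (z n)) powr p"
        by (intro norm_duality_map_mult_le[OF p]) auto
      then show ?thesis
        using Cauchy_Schwarz_ineq2[of "duality_map p (x n + t *\<^sub>R z n)" "z n"] by simp
    qed
    then have bound: "norm (?g t n) \<le> (norm (x n) + norm (z n)) powr p" if "t \<in> {0<..<1}" for t n
      using that by simp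
    have "\<forall>\<^sub>F t in at_right (0::real). t \<in> {0<..<1}"
      by (rule eventually_at_right_real) simp
    then have "\<forall>\<^sub>F nt in (at_top :: nat filter) \<times>\<^sub>F at_right (0::real). snd nt \<in> {0<..<1}"
      using filterlim_snd by (rule eventually_compose_filterlim)
    then show ?thesis
      by (rule eventually_mono) (auto simp del: real_norm_def intro!: bound)
  qed
  moreover have "summable (\<lambda>n. (norm (x n) + norm (z n)) powr p)"
    using p x z by (intro summable_add_norm_powr) auto
  ultimately have "((\<lambda>t. \<Sum>n. ?g t n) \<longlongrightarrow> (\<Sum>n. duality_map p (x n) \<bullet> z n)) (at_right 0)"
    by (intro tannerys_theorem[THEN conjunct2, THEN conjunct2]) auto
  moreover have "\<forall>\<^sub>F t in at_right 0. 0 \<le> (\<Sum>n. ?g t n)"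
    using nonneg by (auto simp: eventually_at_filter)
  ultimately show ?thesis
    by (intro tendsto_lowerbound) auto
qed

section \<open>Birkhoff-James orthogonality\<close>

lemma lp_norm_le_iff:
  assumes "0 < p" and "x \<in> lp p" and "y \<in> lp p"
  shows "lp_norm p x \<le> lp_norm p y \<longleftrightarrow> (\<Sum>n. norm (x n) powr p) \<le> (\<Sum>n. norm (y n) powr p)"
proof -
  have nonneg: "0 \<le> (\<Sum>n. norm (x n) powr p)" "0 \<le> (\<Sum>n. norm (y n) powr p)"
    using assms by (auto simp: lp_def intro: suminf_nonneg)
  have r: "0 < 1 / p"
    using assms(1) by simp
  show ?thesis
    unfolding lp_norm_def
  proof
    assume "(\<Sum>n. norm (x n) powr p) \<le> (\<Sum>n. norm (y n) powr p)"
    then show "(\<Sum>n. norm (x n) powr p) powr (1 / p) \<le> (\<Sum>n. norm (y n) powr p) powr (1 / p)"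
      using r nonneg by (intro powr_mono2) auto
  next
    assume le: "(\<Sum>n. norm (x n) powr p) powr (1 / p) \<le> (\<Sum>n. norm (y n) powr p) powr (1 / p)"
    show "(\<Sum>n. norm (x n) powr p) \<le> (\<Sum>n. norm (y n) powr p)"
    proof (rule leI, rule notI)
      assume "(\<Sum>n. norm (y n) powr p) < (\<Sum>n. norm (x n) powr p)"
      from powr_less_mono2[OF r nonneg(2) this] le show False
        by linarith
    qed
  qed
qed

text \<open>
  The two classes together cover \<open>\<real>\<close> and \<open>\<complex>\<close> at once: scalar multiples come from the field
  structure, gradients from the underlying real inner product.
\<close>

lemma bj_orthogonal_iff_gradient_zero:
  fixes x y :: "nat \<Rightarrow> 'a::{real_normed_field, real_inner}"
  assumes p: "1 < p" and x: "x \<in> lp p" and y: "y \<in> lp p"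
  shows "bj_orthogonal p x y \<longleftrightarrow> (\<forall>c. (\<Sum>n. duality_map p (x n) \<bullet> (c * y n)) = 0)"
proof -
  have xs: "summable (\<lambda>n. norm (x n) powr p)"
    using x by (simp add: lp_def)
  have cy: "summable (\<lambda>n. norm (c * y n) powr p)" for c
    using y summable_mult[of "\<lambda>n. norm (y n) powr p" "norm c powr p"]
    by (simp add: lp_def norm_mult powr_mult)
  have "(\<lambda>n. x n + c * y n) \<in> lp p" for c
    using p summable_norm_add_powr[OF _ xs cy[of c]] by (simp add: lp_def)
  then have bj: "bj_orthogonal p x y \<longleftrightarrow>
      (\<forall>c. (\<Sum>n. norm (x n) powr p) \<le> (\<Sum>n. norm (x n + c * y n) powr p))"
    using p x by (simp add: bj_orthogonal_def lp_norm_le_iff)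
  have "(\<Sum>n. duality_map p (x n) \<bullet> (c * y n)) = 0" if "bj_orthogonal p x y" for c
  proof -
    have nonneg: "0 \<le> (\<Sum>n. duality_map p (x n) \<bullet> (d * y n))" for d
    proof (rule minimum_imp_gradient_nonneg[OF p xs cy])
      show "(\<Sum>n. norm (x n) powr p) \<le> (\<Sum>n. norm (x n + t *\<^sub>R (d * y n)) powr p)" for t
        using bj[THEN iffD1, OF that, rule_format, of "t *\<^sub>R d"] by simp
    qed
    have "(\<Sum>n. duality_map p (x n) \<bullet> (- c * y n)) = - (\<Sum>n. duality_map p (x n) \<bullet> (c * y n))"
      using suminf_minus[OF summable_inner_duality_map[OF p xs cy[of c]]] by simp
    then show ?thesis
      using nonneg[of c] nonneg[of "- c"] by simp
  qed
  moreover have "bj_orthogonal p x y" if "\<forall>c. (\<Sum>n. duality_map p (x n) \<bullet> (c * y n)) = 0"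
    using that gradient_zero_imp_minimum[OF p xs cy] bj by blast
  ultimately show ?thesis by blast
qed

lemma bj_orthogonal_real_iff:
  fixes x y :: "nat \<Rightarrow> real"
  assumes p: "1 < p" and x: "x \<in> lp p" and y: "y \<in> lp p"
  shows "bj_orthogonal p x y \<longleftrightarrow> (\<lambda>n. sgn (x n) * \<bar>x n\<bar> powr (p - 1) * y n) sums 0"
proof -
  let ?f = "\<lambda>n. sgn (x n) * \<bar>x n\<bar> powr (p - 1) * y n"
  have f: "summable ?f"
    using summable_inner_duality_map[OF p, of x y] x y
    by (simp add: lp_def duality_map_def mult_ac)
  have "(\<Sum>n. duality_map p (x n) \<bullet> (c * y n)) = c * suminf ?f" for c
    using suminf_mult[OF f, of c] by (simp add: duality_map_def mult_ac)
  then have "bj_orthogonal p x y \<longleftrightarrow> (\<forall>c. c * suminf ?f = 0)"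
    using bj_orthogonal_iff_gradient_zero[OF assms] by simp
  also have "\<dots> \<longleftrightarrow> suminf ?f = 0"
    by (auto dest: spec[of _ 1])
  also have "\<dots> \<longleftrightarrow> ?f sums 0"
    using f by (simp add: sums_iff)
  finally show ?thesis .
qed

lemma bj_orthogonal_complex_iff:
  fixes x y :: "nat \<Rightarrow> complex"
  assumes p: "1 < p" and x: "x \<in> lp p" and y: "y \<in> lp p"
  shows "bj_orthogonal p x y \<longleftrightarrow>
    (\<lambda>n. cnj (sgn (x n)) * complex_of_real (cmod (x n) powr (p - 1)) * y n) sums 0"
proof -
  let ?f = "\<lambda>n. cnj (sgn (x n)) * complex_of_real (cmod (x n) powr (p - 1)) * y n"
  have f_eq: "?f n = cnj (duality_map p (x n)) * y n" for n
    by (simp add: duality_map_def scaleR_conv_of_real mult_ac)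
  have f: "summable ?f"
    unfolding f_eq using summable_duality_map_mult[OF p, of x y] x y
    by - (rule summable_norm_cancel, simp add: lp_def norm_mult)
  have "duality_map p (x n) \<bullet> (c * y n) = Re (c * ?f n)" for c n
    unfolding f_eq by (simp add: inner_complex_def algebra_simps)
  then have "(\<Sum>n. duality_map p (x n) \<bullet> (c * y n)) = Re (c * suminf ?f)" for c
    using sums_Re[OF sums_mult[OF summable_sums[OF f], of c]] by (simp add: sums_iff)
  then have "bj_orthogonal p x y \<longleftrightarrow> (\<forall>c. Re (c * suminf ?f) = 0)"
    using bj_orthogonal_iff_gradient_zero[OF assms] by simp
  also have "\<dots> \<longleftrightarrow> suminf ?f = 0"
  proof
    assume "\<forall>c. Re (c * suminf ?f) = 0"
    then have "Re (cnj (suminf ?f) * suminf ?f) = 0" by blast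
    then show "suminf ?f = 0" by (simp add: complex_eq_iff)
  qed simp
  also have "\<dots> \<longleftrightarrow> ?f sums 0"
    using f by (simp add: sums_iff)
  finally show ?thesis .
qed

theorem theorem4p3:
  fixes p :: real
  assumes "1 < p" and "p \<noteq> 2"
  shows "(\<forall>x \<in> lp p. \<forall>y \<in> lp p. bj_orthogonal p x y \<longleftrightarrow>
            (\<lambda>n. sgn (x n :: real) * \<bar>x n\<bar> powr (p - 1) * y n) sums 0)
       \<and> (\<forall>x \<in> lp p. \<forall>y \<in> lp p. bj_orthogonal p x y \<longleftrightarrow>
            (\<lambda>n. cnj (sgn (x n :: complex)) * complex_of_real (cmod (x n) powr (p - 1)) * y n) sums 0)"
  using bj_orthogonal_real_iff[OF assms(1)] bj_orthogonal_complex_iff[OF assms(1)] by blast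

end
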